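(* Let $(X,Y,\langle\cdot,\cdot\rangle)$ be a dual system, let $n\in\{2,3,\dots\}\cup\{\infty\}$, and let $T:X\rightrightarrows Y$. Then (i) $[\varphi_T^{\langle n-1\rangle}\le c]=\{(x,y)\in X\times Y\mid (x,y)\text{ is }n\text{-monotonically related to }T\}$; (ii) $T$ is $n$-monotone if and only if $\operatorname{Graph}T\subset[\varphi_T^{\langle n-1\rangle}\le c]$, if and only if $\operatorname{Graph}T\subset[\varphi_T^{\langle n-1\rangle}=c]$.
   Context: All vector spaces are real. A dual system $(X,Y,\langle\cdot,\cdot\rangle)$ consists of vector spaces $X,Y$ and a bilinear map $c=\langle\cdot,\cdot\rangle:X\times Y\to\mathbb{R}$, $c(x,y)=\langle x,y\rangle$. For $T:X\rightrightarrows Y$, $\operatorname{Graph}T=\{(x,y)\mid y\in T(x)\}$. $[f\le g]=\{z\mid f(z)\le g(z)\}$, and similarly $[f=g]$. Conventions: $\sup\emptyset=-\infty$, $\infty-1=\infty$. For finite $n$, $T$ is $n$-monotone if $\sum_{i=1}^n\langle x_i-x_{i+1},y_i\rangle\ge0$ for all $(x_1,y_1),\dots,(x_n,y_n)\in\operatorname{Graph}T$, with $x_{n+1}=x_1$; $T$ is $\infty$-monotone if it is $k$-monotone for every integer $k\ge2$. For finite $n\ge2$, $(x,y)\in X\times Y$ is $n$-monotonically related to $T$ if for all $(x_1,y_1),\dots,(x_{n-1},y_{n-1})\in\operatorname{Graph}T$, $\langle x-x_{n-1},y\rangle+\langle x_{n-1}-x_{n-2},y_{n-1}\rangle+\dots+\langle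 x_2-x_1,y_2\rangle+\langle x_1-x,y_1\rangle\ge0$; it is $\infty$-monotonically related to $T$ if it is $n$-monotonically related to $T$ for every integer $n\ge2$. For finite $n\ge1$, $\varphi_T^{\langle n\rangle}(x,y)=\sup\{\langle x-x_1,y_1\rangle+\sum_{i=2}^n\langle x_{i-1}-x_i,y_i\rangle+\langle x_n,y\rangle\mid (x_i,y_i)\in\operatorname{Graph}T,\ 1\le i\le n\}$, and $\varphi_T^{\langle\infty\rangle}=\sup_{n\ge1}\varphi_T^{\langle n\rangle}$. *)

theory Defs
  imports "HOL-Analysis.Linear_Algebra" "HOL-Library.Extended_Real"
begin

definition Graph :: "('x \<Rightarrow> 'y set) \<Rightarrow> ('x \<times> 'y) set" where
  "Graph T = {(x, y). y \<in> T x}"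

text \<open>
  The order is an \<open>enat\<close>; points \<open>(x\<^sub>1, y\<^sub>1), \<dots>, (x\<^sub>n, y\<^sub>n)\<close> are sequences of which only the
  indices \<open>1, \<dots>, n\<close> matter, except that \<open>x (n + 1)\<close> is used to close the cycle in
  \<open>monotone_fin\<close>. The definitions for finite order are meant for \<open>n \<ge> 1\<close> (\<open>monotone_fin\<close>,
  \<open>fitzpatrick_fin\<close>) and \<open>n \<ge> 2\<close> (\<open>monotonically_related_fin\<close>).
\<close>

definition monotone_fin ::
  "('x::real_vector \<Rightarrow> 'y::real_vector \<Rightarrow> real) \<Rightarrow> nat \<Rightarrow> ('x \<Rightarrow> 'y set) \<Rightarrow> bool" where
  "monotone_fin c n T \<longleftrightarrow>
    (\<forall>x y. (\<forall>i\<in>{1..n}. (x i, y i) \<in> Graph T) \<longrightarrow> x (n + 1) = x 1 \<longrightarrow>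
      0 \<le> (\<Sum>i=1..n. c (x i - x (i + 1)) (y i)))"

definition n_monotone ::
  "('x::real_vector \<Rightarrow> 'y::real_vector \<Rightarrow> real) \<Rightarrow> enat \<Rightarrow> ('x \<Rightarrow> 'y set) \<Rightarrow> bool" where
  "n_monotone c n T \<longleftrightarrow>
    (case n of enat m \<Rightarrow> monotone_fin c m T | \<infinity> \<Rightarrow> (\<forall>k\<ge>2. monotone_fin c k T))"

definition monotonically_related_fin ::
  "('x::real_vector \<Rightarrow> 'y::real_vector \<Rightarrow> real) \<Rightarrow> nat \<Rightarrow> ('x \<Rightarrow> 'y set) \<Rightarrow> 'x \<times> 'y \<Rightarrow> bool" where
  "monotonically_related_fin c n T = (\<lambda>(u, v).
    \<forall>x y. (\<forall>i\<in>{1..n - 1}. (x i, y i) \<in> Graph T) \<longrightarrow>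
      0 \<le> c (u - x (n - 1)) v + (\<Sum>i=2..n - 1. c (x i - x (i - 1)) (y i)) + c (x 1 - u) (y 1))"

definition n_monotonically_related ::
  "('x::real_vector \<Rightarrow> 'y::real_vector \<Rightarrow> real) \<Rightarrow> enat \<Rightarrow> ('x \<Rightarrow> 'y set) \<Rightarrow> 'x \<times> 'y \<Rightarrow> bool" where
  "n_monotonically_related c n T z \<longleftrightarrow>
    (case n of enat m \<Rightarrow> monotonically_related_fin c m T z
     | \<infinity> \<Rightarrow> (\<forall>k\<ge>2. monotonically_related_fin c k T z))"

text \<open>On \<open>ereal\<close> the supremum of the empty set is \<open>- \<infinity>\<close>, as wanted for an empty graph.\<close>

definition fitzpatrick_fin ::
  "('x::real_vector \<Rightarrow> 'y::real_vector \<Rightarrow> real) \<Rightarrow> nat \<Rightarrow> ('x \<Rightarrow> 'y set) \<Rightarrow> 'x \<times> 'y \<Rightarrow> ereal" where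
  "fitzpatrick_fin c n T = (\<lambda>(u, v).
    Sup {ereal (c (u - x 1) (y 1) + (\<Sum>i=2..n. c (x (i - 1) - x i) (y i)) + c (x n) v) | x y.
      \<forall>i\<in>{1..n}. (x i, y i) \<in> Graph T})"

definition fitzpatrick ::
  "('x::real_vector \<Rightarrow> 'y::real_vector \<Rightarrow> real) \<Rightarrow> enat \<Rightarrow> ('x \<Rightarrow> 'y set) \<Rightarrow> 'x \<times> 'y \<Rightarrow> ereal" where
  "fitzpatrick c n T z =
    (case n of enat m \<Rightarrow> fitzpatrick_fin c m T z | \<infinity> \<Rightarrow> (SUP k\<in>{1..}. fitzpatrick_fin c k T z))"

end

theory Submission
  imports Defs
begin

text \<open>
  Everything rests on one computation. The expression whose sign defines \<open>m + 1\<close>-monotone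
  relatedness of \<open>(u, v)\<close> is \<open>c u v\<close> minus the expression under the supremum in the Fitzpatrick
  function of order \<open>m\<close>, evaluated at the same \<open>m\<close> graph points. Hence relatedness says that
  \<open>c u v\<close> is an upper bound of the set whose supremum is taken, which is
  \<open>fitzpatrick_fin_le_iff_related\<close>. It is also the cyclic sum that defines \<open>m + 1\<close>-monotonicity,
  taken along the cycle through \<open>(u, v)\<close> and the \<open>m\<close> points in reverse order. So \<open>T\<close> is
  \<open>m + 1\<close>-monotone precisely when every point of its graph is related to \<open>T\<close>, which is
  \<open>monotone_fin_iff_Graph_related\<close>.

  The inequality can be replaced by an equality on the graph because the reverse inequality
  always holds there: repeating a graph point \<open>(u, v)\<close> itself \<open>m\<close> times makes all differences
  vanish and leaves \<open>c u v\<close>. The case of order \<open>\<infinity>\<close> follows by quantifying over all finite orders.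
\<close>

text \<open>
  The two sums run through the same cycle \<open>u \<rightarrow> x m \<rightarrow> \<dots> \<rightarrow> x 1 \<rightarrow> u\<close>: the sequences \<open>z\<close> and
  \<open>w\<close> number its vertices in the order in which it passes them, starting at \<open>u\<close>, while \<open>x\<close> and
  \<open>y\<close> number the remaining vertices backwards.
\<close>

lemma cyclic_sum_reverse:
  fixes c :: "'x::real_vector \<Rightarrow> 'y::real_vector \<Rightarrow> real"
    and x z :: "nat \<Rightarrow> 'x" and y w :: "nat \<Rightarrow> 'y"
  assumes m: "m \<ge> 1"
    and z: "z 1 = u" "z (m + 2) = u" "w 1 = v"
    and x: "\<And>i. i \<in> {1..m} \<Longrightarrow> x i = z (m + 2 - i)"
    and y: "\<And>i. i \<in> {1..m} \<Longrightarrow> y i = w (m + 2 - i)"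
  shows "(\<Sum>i=1..m + 1. c (z i - z (i + 1)) (w i)) =
    c (u - x m) v + (\<Sum>i=2..m. c (x i - x (i - 1)) (y i)) + c (x 1 - u) (y 1)"
proof -
  let ?f = "\<lambda>i. c (z i - z (i + 1)) (w i)"
  have split: "(\<Sum>i=1..m + 1. ?f i) = ?f 1 + (\<Sum>i=2..m. ?f i) + ?f (m + 1)"
    using m by (simp add: sum.atLeast_Suc_atMost numeral_2_eq_2)
  have "(\<Sum>i=2..m. ?f i) = (\<Sum>i=2..m. ?f (m + 2 - i))"
    by (rule sum.atLeastAtMost_rev)
  also have "\<dots> = (\<Sum>i=2..m. c (x i - x (i - 1)) (y i))"
  proof (rule sum.cong)
    fix i assume i: "i \<in> {2..m}"
    then have "m + 2 - (i - 1) = m + 2 - i + 1" and "i \<in> {1..m}" "i - 1 \<in> {1..m}" by auto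
    with x[of i] x[of "i - 1"] y[of i]
    show "?f (m + 2 - i) = c (x i - x (i - 1)) (y i)" by simp
  qed simp
  finally show ?thesis
    using split m z x[of 1] x[of m] y[of 1] by (simp add: numeral_2_eq_2)
qed

lemma fitzpatrick_fin_le_iff_related:
  assumes c: "bilinear c"
  shows "fitzpatrick_fin c m T (u, v) \<le> ereal (c u v)
    \<longleftrightarrow> monotonically_related_fin c (m + 1) T (u, v)"
proof -
  have key: "c (u - x m) v + (\<Sum>i=2..m. c (x i - x (i - 1)) (y i)) + c (x 1 - u) (y 1)
      = c u v - (c (u - x 1) (y 1) + (\<Sum>i=2..m. c (x (i - 1) - x i) (y i)) + c (x m) v)"
    for x y
  proof -
    have "(\<Sum>i=2..m. c (x i - x (i - 1)) (y i)) = - (\<Sum>i=2..m. c (x (i - 1) - x i) (y i))"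
      unfolding sum_negf[symmetric] by (simp add: bilinear_lsub[OF c])
    then show ?thesis
      by (simp add: bilinear_lsub[OF c])
  qed
  have "fitzpatrick_fin c m T (u, v) \<le> ereal (c u v) \<longleftrightarrow>
      (\<forall>x y. (\<forall>i\<in>{1..m}. (x i, y i) \<in> Graph T) \<longrightarrow>
        ereal (c (u - x 1) (y 1) + (\<Sum>i=2..m. c (x (i - 1) - x i) (y i)) + c (x m) v)
          \<le> ereal (c u v))"
    unfolding fitzpatrick_fin_def prod.case Sup_le_iff by blast
  then show ?thesis
    unfolding monotonically_related_fin_def prod.case add_diff_cancel_right' key
    by simp
qed

lemma monotone_fin_iff_Graph_related:
  assumes m: "m \<ge> 1"
  shows "monotone_fin c (m + 1) T
    \<longleftrightarrow> (\<forall>p\<in>Graph T. monotonically_related_fin c (m + 1) T p)"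
proof (intro iffI ballI)
  fix p assume mono: "monotone_fin c (m + 1) T" and p: "p \<in> Graph T"
  obtain u v where uv: "p = (u, v)" by (cases p)
  have "0 \<le> c (u - x m) v + (\<Sum>i=2..m. c (x i - x (i - 1)) (y i)) + c (x 1 - u) (y 1)"
    if xy: "\<forall>i\<in>{1..m}. (x i, y i) \<in> Graph T" for x y
  proof -
    define z where "z i = (if i = 1 \<or> i = m + 2 then u else x (m + 2 - i))" for i
    define w where "w i = (if i = 1 then v else y (m + 2 - i))" for i
    have "(z i, w i) \<in> Graph T" if i: "i \<in> {1..m + 1}" for i
    proof (cases "i = 1")
      case False
      with i have "m + 2 - i \<in> {1..m}" by auto
      with xy i False show ?thesis unfolding z_def w_def by simp
    qed (use p in \<open>simp add: uv z_def w_def\<close>)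
    moreover have "z (m + 1 + 1) = z 1" by (simp add: z_def)
    ultimately have "0 \<le> (\<Sum>i=1..m + 1. c (z i - z (i + 1)) (w i))"
      using mono unfolding monotone_fin_def by blast
    also have "\<dots> = c (u - x m) v + (\<Sum>i=2..m. c (x i - x (i - 1)) (y i)) + c (x 1 - u) (y 1)"
      by (rule cyclic_sum_reverse[OF m]) (auto simp: z_def w_def)
    finally show ?thesis .
  qed
  then show "monotonically_related_fin c (m + 1) T p"
    unfolding monotonically_related_fin_def uv by simp
next
  assume rel: "\<forall>p\<in>Graph T. monotonically_related_fin c (m + 1) T p"
  show "monotone_fin c (m + 1) T"
    unfolding monotone_fin_def
  proof (intro allI impI)
    fix z w
    assume zw: "\<forall>i\<in>{1..m + 1}. (z i, w i) \<in> Graph T" and closed: "z (m + 1 + 1) = z 1"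
    define x where "x i = z (m + 2 - i)" for i
    define y where "y i = w (m + 2 - i)" for i
    have "\<forall>i\<in>{1..m}. (x i, y i) \<in> Graph T"
      unfolding x_def y_def by (intro ballI zw[rule_format]) auto
    moreover have "monotonically_related_fin c (m + 1) T (z 1, w 1)"
      using rel zw by simp
    ultimately have
      "0 \<le> c (z 1 - x m) (w 1) + (\<Sum>i=2..m. c (x i - x (i - 1)) (y i)) + c (x 1 - z 1) (y 1)"
      unfolding monotonically_related_fin_def by simp
    also have "\<dots> = (\<Sum>i=1..m + 1. c (z i - z (i + 1)) (w i))"
      by (rule cyclic_sum_reverse[OF m, symmetric]) (use closed in \<open>auto simp: x_def y_def\<close>)
    finally show "0 \<le> (\<Sum>i=1..m + 1. c (z i - z (i + 1)) (w i))" .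
  qed
qed

lemma fitzpatrick_fin_ge_on_Graph:
  assumes c: "bilinear c" and uv: "(u, v) \<in> Graph T"
  shows "ereal (c u v) \<le> fitzpatrick_fin c m T (u, v)"
  unfolding fitzpatrick_fin_def prod.case
proof (rule Sup_upper, unfold mem_Collect_eq, intro exI conjI)
  let ?x = "\<lambda>_::nat. u" and ?y = "\<lambda>_::nat. v"
  show "ereal (c u v) = ereal (c (u - ?x 1) (?y 1)
      + (\<Sum>i=2..m. c (?x (i - 1) - ?x i) (?y i)) + c (?x m) v)"
    by (simp add: bilinear_lzero[OF c])
  show "\<forall>i\<in>{1..m}. (?x i, ?y i) \<in> Graph T"
    using uv by simp
qed

text \<open>
  At order \<open>\<infinity>\<close>, matches the orders \<open>k \<ge> 2\<close> of relatedness and monotonicity with the orders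
  \<open>k \<ge> 1\<close> over which the supremum of the Fitzpatrick functions is taken.
\<close>

lemma all_ge_2_iff_all_Suc: "(\<forall>k\<ge>2. P k) \<longleftrightarrow> (\<forall>k\<ge>1. P (k + 1))" for P :: "nat \<Rightarrow> bool"
proof (intro iffI allI impI)
  fix k :: nat assume P: "\<forall>k\<ge>1. P (k + 1)" and "2 \<le> k"
  then have "P (k - 1 + 1)" by (intro P[rule_format]) simp
  with \<open>2 \<le> k\<close> show "P k" by simp
qed simp

lemma enat_ge_2_cases:
  assumes "n \<ge> (2::enat)"
  obtains (fin) m where "m \<ge> 1" "n = enat (m + 1)" "n - 1 = enat m" | (inf) "n = \<infinity>" "n - 1 = \<infinity>"
proof (cases n)
  case (enat k)
  with assms have "k \<ge> 2" by (simp add: numeral_eq_enat)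
  with enat have "k - 1 \<ge> 1" "n = enat (k - 1 + 1)" "n - 1 = enat (k - 1)"
    by (auto simp: one_enat_def)
  then show ?thesis by (rule fin)
qed (use inf in simp)

lemma fitzpatrick_le_iff_related:
  assumes "bilinear c" "n \<ge> 2"
  shows "fitzpatrick c (n - 1) T (u, v) \<le> ereal (c u v)
    \<longleftrightarrow> n_monotonically_related c n T (u, v)"
  using assms(2)
proof (cases rule: enat_ge_2_cases)
  case (fin m)
  then show ?thesis
    by (simp add: fitzpatrick_def n_monotonically_related_def fitzpatrick_fin_le_iff_related[OF assms(1)])
next
  case inf
  then show ?thesis
    by (simp add: fitzpatrick_def n_monotonically_related_def SUP_le_iff all_ge_2_iff_all_Suc
        fitzpatrick_fin_le_iff_related[OF assms(1)] Ball_def)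
qed

lemma n_monotone_iff_Graph_related:
  assumes "n \<ge> 2"
  shows "n_monotone c n T \<longleftrightarrow> (\<forall>p\<in>Graph T. n_monotonically_related c n T p)"
  using assms
proof (cases rule: enat_ge_2_cases)
  case (fin m)
  then show ?thesis
    using monotone_fin_iff_Graph_related[of m c T]
    by (simp add: n_monotone_def n_monotonically_related_def)
next
  case inf
  have "(\<forall>k\<ge>1. monotone_fin c (k + 1) T)
      \<longleftrightarrow> (\<forall>k\<ge>1. \<forall>p\<in>Graph T. monotonically_related_fin c (k + 1) T p)"
    using monotone_fin_iff_Graph_related by blast
  then show ?thesis
    unfolding inf n_monotone_def n_monotonically_related_def enat.case all_ge_2_iff_all_Suc
    by blast
qed

lemma fitzpatrick_ge_on_Graph:
  assumes "bilinear c" "n \<ge> 2" "(u, v) \<in> Graph T"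
  shows "ereal (c u v) \<le> fitzpatrick c (n - 1) T (u, v)"
  using assms(2)
proof (cases rule: enat_ge_2_cases)
  case (fin m)
  then show ?thesis
    by (simp add: fitzpatrick_def fitzpatrick_fin_ge_on_Graph[OF assms(1,3)])
next
  case inf
  then show ?thesis
    by (auto simp: fitzpatrick_def intro!: SUP_upper2[of 1] fitzpatrick_fin_ge_on_Graph[OF assms(1,3)])
qed

theorem theorem10:
  fixes c :: "'x::real_vector \<Rightarrow> 'y::real_vector \<Rightarrow> real"
    and T :: "'x \<Rightarrow> 'y set"
    and n :: enat
  assumes "bilinear c" and "n \<ge> 2"
  shows "{(x, y). fitzpatrick c (n - 1) T (x, y) \<le> ereal (c x y)}
        = {(x, y). n_monotonically_related c n T (x, y)}
    \<and> (n_monotone c n T \<longleftrightarrow>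
          Graph T \<subseteq> {(x, y). fitzpatrick c (n - 1) T (x, y) \<le> ereal (c x y)})
    \<and> (n_monotone c n T \<longleftrightarrow>
          Graph T \<subseteq> {(x, y). fitzpatrick c (n - 1) T (x, y) = ereal (c x y)})"
proof (intro conjI)
  show "{(x, y). fitzpatrick c (n - 1) T (x, y) \<le> ereal (c x y)}
      = {(x, y). n_monotonically_related c n T (x, y)}"
    by (simp add: fitzpatrick_le_iff_related[OF assms])
  show le: "n_monotone c n T \<longleftrightarrow>
      Graph T \<subseteq> {(x, y). fitzpatrick c (n - 1) T (x, y) \<le> ereal (c x y)}"
    by (auto simp: fitzpatrick_le_iff_related[OF assms] n_monotone_iff_Graph_related[OF assms(2)])
  have "Graph T \<subseteq> {(x, y). fitzpatrick c (n - 1) T (x, y) \<le> ereal (c x y)} \<longleftrightarrow>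
      Graph T \<subseteq> {(x, y). fitzpatrick c (n - 1) T (x, y) = ereal (c x y)}"
    using fitzpatrick_ge_on_Graph[OF assms] by (auto intro: antisym)
  with le show "n_monotone c n T \<longleftrightarrow>
      Graph T \<subseteq> {(x, y). fitzpatrick c (n - 1) T (x, y) = ereal (c x y)}"
    by simp
qed

end
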